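(* Let $\bar\beta_0+\sum_{j=1}^n\bar\beta_jx_j+\beta' y\ge 0$ and $\hat\beta_0+\sum_{j=1}^n\hat\beta_jx_j+\beta' y\ge 0$ be any two valid core inequalities (with the same $\beta'$), and suppose that the following conditions hold. 1. $\bar\beta_i=\bar\beta_j$ for each pair $(i,j)$, $i<j$, having $\hat\beta_i=\hat\beta_j$. 2. $\{k:\mathcal{L}_k(\hat\beta_0,\hat\beta)+\beta' m(x^k)=0\}\subset\{k:\mathcal{L}_k(\bar\beta_0,\bar\beta)+\beta' m(x^k)=0\}$, where $k$ ranges over $\{0,\dots,n\}$ and $\subset$ denotes proper inclusion. Then the inequality $\hat\beta_0+\sum_{j=1}^n\hat\beta_jx_j+\beta' y\ge 0$ is not a facet of $\operatorname{conv}(G)$.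
   Context: Let $n\ge 2$, $N=\{1,\dots,n\}$, and let $\ell<u$ be real numbers. Let $X=\{x\in\mathbb{R}^n:\ell\le x_j\le u,\ j\in N\}$. For real coefficients $c_2,\dots,c_n$, not all zero, let $m(x)=\sum_{i=2}^n c_i\sum_{J\subseteq N,\ |J|=i}\prod_{j\in J}x_j$, and let $G=\{(x,y)\in\mathbb{R}^n\times\mathbb{R}: x\in X,\ y=m(x)\}$. The set $\operatorname{conv}(G)$ is a polytope of dimension $n+1$. For $k=0,\dots,n$, $x^k\in\mathbb{R}^n$ has its first $k$ entries equal to $u$ and its last $n-k$ entries equal to $\ell$. A core inequality is a linear inequality $\beta_0+\sum_{j=1}^n\beta_jx_j+\beta' y\ge 0$ with $\beta'\in\{-1,1\}$ and $\beta_1\le\cdots\le\beta_n$; it is a valid core inequality if it is satisfied by all points of $\operatorname{conv}(G)$. An inequality "is a facet" of $\operatorname{conv}(G)$ if it is valid for $\operatorname{conv}(G)$ and the set of points of $\operatorname{conv}(G)$ satisfying it with equality is a facet of $\operatorname{conv}(G)$. For $k\in\{0,\dots,n\}$, $\mathcal{L}_k(\beta_0,\beta)=\beta_0+u\sum_{j=1}^k\beta_j+\ell\sum_{j=k+1}^n\beta_j$ (empty sums are $0$). *)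

theory Defs
  imports "HOL-Analysis.Analysis"
begin

text \<open>
  The index set \<open>N = {1, ..., n}\<close> is a finite linearly ordered type \<open>'n\<close>, with \<open>n = CARD('n)\<close>;
  the order gives meaning to ``the first \<open>k\<close> entries'' and to \<open>\<beta>\<^sub>1 \<le> ... \<le> \<beta>\<^sub>n\<close>.
  The number in \<open>{1, ..., n}\<close> that an index stands for is the following rank (counted from 1).
\<close>

definition pos :: "'n::{finite,linorder} \<Rightarrow> nat" where
  "pos j = card {..j}"

definition boxX :: "real \<Rightarrow> real \<Rightarrow> (real ^ 'n::{finite,linorder}) set" where
  "boxX l u = {x. \<forall>j. l \<le> x $ j \<and> x $ j \<le> u}"

text \<open>Only the values \<open>c i\<close> with \<open>2 \<le> i \<le> n\<close> are used.\<close>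

definition mfun :: "(nat \<Rightarrow> real) \<Rightarrow> real ^ 'n::{finite,linorder} \<Rightarrow> real" where
  "mfun c x = (\<Sum>i = 2..CARD('n). c i * (\<Sum>J | J \<subseteq> (UNIV :: 'n set) \<and> card J = i. \<Prod>j\<in>J. x $ j))"

definition graphG :: "real \<Rightarrow> real \<Rightarrow> (nat \<Rightarrow> real) \<Rightarrow> ((real ^ 'n::{finite,linorder}) \<times> real) set" where
  "graphG l u c = {(x, y). x \<in> boxX l u \<and> y = mfun c x}"

definition xvec :: "real \<Rightarrow> real \<Rightarrow> nat \<Rightarrow> real ^ 'n::{finite,linorder}" where
  "xvec l u k = (\<chi> j. if pos j \<le> k then u else l)"

text \<open>
  The inequality \<open>\<beta>\<^sub>0 + \<Sum>\<^sub>j \<beta>\<^sub>j x\<^sub>j + \<beta>' y \<ge> 0\<close> is represented by its coefficients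
  \<open>b0 = \<beta>\<^sub>0\<close>, \<open>b = \<beta>\<close>, \<open>b' = \<beta>'\<close>.
\<close>

definition lhs :: "real \<Rightarrow> real ^ 'n \<Rightarrow> real \<Rightarrow> (real ^ 'n) \<times> real \<Rightarrow> real" where
  "lhs b0 b b' = (\<lambda>(x, y). b0 + (\<Sum>j\<in>UNIV. b $ j * x $ j) + b' * y)"

definition valid_ineq ::
    "((real ^ 'n) \<times> real) set \<Rightarrow> real \<Rightarrow> real ^ 'n \<Rightarrow> real \<Rightarrow> bool" where
  "valid_ineq S b0 b b' \<longleftrightarrow> (\<forall>p\<in>S. lhs b0 b b' p \<ge> 0)"

definition core_ineq :: "real ^ 'n::{finite,linorder} \<Rightarrow> real \<Rightarrow> bool" where
  "core_ineq b b' \<longleftrightarrow> b' \<in> {-1, 1} \<and> (\<forall>i j. i \<le> j \<longrightarrow> b $ i \<le> b $ j)"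

definition valid_core_ineq ::
    "((real ^ 'n::{finite,linorder}) \<times> real) set \<Rightarrow> real \<Rightarrow> real ^ 'n::{finite,linorder} \<Rightarrow> real \<Rightarrow> bool" where
  "valid_core_ineq S b0 b b' \<longleftrightarrow> core_ineq b b' \<and> valid_ineq S b0 b b'"

definition is_facet_ineq ::
    "((real ^ 'n) \<times> real) set \<Rightarrow> real \<Rightarrow> real ^ 'n \<Rightarrow> real \<Rightarrow> bool" where
  "is_facet_ineq S b0 b b' \<longleftrightarrow> valid_ineq S b0 b b' \<and> {p \<in> S. lhs b0 b b' p = 0} facet_of S"

definition Lk :: "real \<Rightarrow> real \<Rightarrow> nat \<Rightarrow> real \<Rightarrow> real ^ 'n::{finite,linorder} \<Rightarrow> real" where
  "Lk l u k b0 b = b0 + u * (\<Sum>j | pos j \<le> k. b $ j) + l * (\<Sum>j | k < pos j. b $ j)"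

end

theory Submission
  imports Defs
begin

text \<open>
  Write \<open>P\<close> for the convex hull of the graph and, for a valid inequality, speak of the face
  of \<open>P\<close> on which it is tight. The plan is to show that the face \<open>F\<close> of the inequality with
  coefficients \<open>hat\<close> is properly contained in the face \<open>F'\<close> of the one with coefficients
  \<open>bar\<close>, and that \<open>F'\<close> is still a proper face. The dimension then drops twice between \<open>P\<close>
  and \<open>F\<close>, so \<open>F\<close> is not a facet.

  Since \<open>m\<close> is affine in each coordinate, \<open>P\<close> is already the convex hull of the graph over the
  \<open>2\<^sup>n\<close> corners of the box (\<open>convex_hull_graph_eq_corners\<close>), and hence every face of \<open>P\<close> is
  the convex hull of the corner points it contains. So for \<open>F \<subseteq> F'\<close> it suffices to look
  at corners.

  Let the corner of \<open>S\<close> have entries \<open>u\<close> on \<open>S\<close> and \<open>l\<close> elsewhere, and put \<open>k = card S\<close>. By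
  symmetry \<open>m\<close> takes the same value there as at \<open>x\<^sup>k\<close>, so the two points differ only in the linear
  part of the inequality, namely by \<open>u - l\<close> times the coefficient sum over \<open>S\<close> minus that over the
  first \<open>k\<close> indices (\<open>lhs_corner\<close>). As the coefficients increase, this difference is nonnegative,
  and it vanishes only if \<open>S\<close> arises from the first \<open>k\<close> indices by exchanging indices with equal
  coefficients (\<open>initial_segment_exchange\<close>). If the \<open>hat\<close> inequality is tight at the corner
  of \<open>S\<close>, it is therefore tight at \<open>x\<^sup>k\<close> as well, and the exchanged indices are ties of \<open>hat\<close>.
  Condition 1 turns them into ties of \<open>bar\<close> and condition 2 gives tightness of \<open>bar\<close> at
  \<open>x\<^sup>k\<close>; together, \<open>bar\<close> is tight at the corner of \<open>S\<close> (\<open>tight_corner_transfer\<close>). The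
  inclusion is proper because condition 2 also provides some \<open>x\<^sup>k\<close> at which only \<open>bar\<close> is tight.

  Finally, if \<open>F' = P\<close>, then \<open>m\<close> would agree with an affine function on the box. On the diagonal
  of the box \<open>m\<close> is a polynomial of degree at least 2, so this is impossible
  (\<open>mfun_not_affine_on_box\<close>).
\<close>

section \<open>Inequalities as affine functions\<close>

lemma lhs_eq_inner: "lhs b0 b b' p = b0 + inner (b, b') p"
  by (cases p) (simp add: lhs_def inner_vec_def)

lemma valid_ineq_face_of:
  assumes "convex S" "valid_ineq S b0 b b'"
  shows "{p \<in> S. lhs b0 b b' p = 0} face_of S"
proof -
  have "{p \<in> S. lhs b0 b b' p = 0} = S \<inter> {p. inner (b, b') p = - b0}"
    by (auto simp: lhs_eq_inner add_eq_0_iff)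
  moreover have "\<And>p. p \<in> S \<Longrightarrow> inner (b, b') p \<ge> - b0"
    using assms(2) by (force simp: valid_ineq_def lhs_eq_inner)
  ultimately show ?thesis
    using face_of_Int_supporting_hyperplane_ge[OF assms(1), of "- b0" "(b, b')"] by simp
qed

section \<open>The symmetric multilinear function\<close>

lemma mfun_affine_in_coordinate:
  fixes x y z :: "real ^ 'n::{finite,linorder}"
  assumes agree: "\<And>j. j \<noteq> a \<Longrightarrow> x $ j = z $ j \<and> y $ j = z $ j"
    and za: "z $ a = (1 - t) * x $ a + t * y $ a"
  shows "mfun c z = (1 - t) * mfun c x + t * mfun c y"
proof -
  have prod: "(\<Prod>j\<in>J. z $ j) = (1 - t) * (\<Prod>j\<in>J. x $ j) + t * (\<Prod>j\<in>J. y $ j)" for J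
  proof (cases "a \<in> J")
    case True
    have "(\<Prod>j\<in>J - {a}. x $ j) = (\<Prod>j\<in>J - {a}. z $ j)" "(\<Prod>j\<in>J - {a}. y $ j) = (\<Prod>j\<in>J - {a}. z $ j)"
      using agree by (auto intro!: prod.cong)
    with True show ?thesis
      by (simp add: prod.remove[of J a] za algebra_simps)
  next
    case False
    then have "(\<Prod>j\<in>J. x $ j) = (\<Prod>j\<in>J. z $ j)" "(\<Prod>j\<in>J. y $ j) = (\<Prod>j\<in>J. z $ j)"
      using agree by (metis (mono_tags, lifting) prod.cong)+
    then show ?thesis by (simp add: algebra_simps)
  qed
  have "(\<Sum>J | J \<subseteq> UNIV \<and> card J = i. \<Prod>j\<in>J. z $ j) =
      (1 - t) * (\<Sum>J | J \<subseteq> UNIV \<and> card J = i. \<Prod>j\<in>J. x $ j)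
        + t * (\<Sum>J | J \<subseteq> UNIV \<and> card J = i. \<Prod>j\<in>J. y $ j)" for i
    by (simp only: prod sum.distrib sum_distrib_left)
  then show ?thesis
    unfolding mfun_def by (simp only: distrib_left sum.distrib sum_distrib_left mult.left_commute)
qed

text \<open>
  Renaming the variables permutes the index sets of each fixed size \<open>i\<close>, all of which carry the
  same weight \<open>c i\<close>.
\<close>

lemma mfun_permute:
  fixes x :: "real ^ 'n::{finite,linorder}" and f :: "'n \<Rightarrow> 'n"
  assumes f: "bij f"
  shows "mfun c (\<chi> j. x $ f j) = mfun c x"
proof -
  have "(\<Sum>J | J \<subseteq> UNIV \<and> card J = i. \<Prod>j\<in>J. x $ f j) = (\<Sum>J | J \<subseteq> UNIV \<and> card J = i. \<Prod>j\<in>J. x $ j)" for i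
  proof -
    have inj: "inj f" using f by (rule bij_is_inj)
    have bij: "bij_betw (image f) {J. J \<subseteq> UNIV \<and> card J = i} {J. J \<subseteq> UNIV \<and> card J = i}"
    proof (rule bij_betwI[where g = "vimage f"])
      show "(`) f \<in> {J. J \<subseteq> UNIV \<and> card J = i} \<rightarrow> {J. J \<subseteq> UNIV \<and> card J = i}"
        using inj by (auto simp: card_image inj_on_subset)
      show "vimage f \<in> {J. J \<subseteq> UNIV \<and> card J = i} \<rightarrow> {J. J \<subseteq> UNIV \<and> card J = i}"
        using f by (auto simp: card_vimage_inj bij_is_inj bij_is_surj)
    qed (use f in \<open>simp_all add: inj_vimage_image_eq bij_is_inj bij_is_surj surj_image_vimage_eq\<close>)
    have "(\<Sum>J | J \<subseteq> UNIV \<and> card J = i. \<Prod>j\<in>J. x $ f j) =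
        (\<Sum>J | J \<subseteq> UNIV \<and> card J = i. \<Prod>j\<in>f ` J. x $ j)"
      using inj by (intro sum.cong refl) (simp add: prod.reindex inj_on_subset)
    also have "\<dots> = (\<Sum>J | J \<subseteq> UNIV \<and> card J = i. \<Prod>j\<in>J. x $ j)"
      by (rule sum.reindex_bij_betw[OF bij])
    finally show ?thesis .
  qed
  then show ?thesis by (simp add: mfun_def)
qed

lemma mfun_diagonal:
  "mfun c ((\<chi> j. t) :: real ^ 'n::{finite,linorder}) = (\<Sum>i = 2..CARD('n). c i * real (CARD('n) choose i) * t ^ i)"
proof -
  have "(\<Sum>J | J \<subseteq> (UNIV :: 'n set) \<and> card J = i. \<Prod>j\<in>J. t) = real (CARD('n) choose i) * t ^ i" for i
  proof -
    have "(\<Sum>J | J \<subseteq> (UNIV :: 'n set) \<and> card J = i. \<Prod>j\<in>J. t) = (\<Sum>J | J \<subseteq> (UNIV :: 'n set) \<and> card J = i. t ^ i)"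
      by (rule sum.cong) auto
    then show ?thesis by (simp only: sum_constant n_subsets[OF finite])
  qed
  then show ?thesis by (simp only: mfun_def vec_lambda_beta mult.assoc)
qed

text \<open>
  At the diagonal point with all entries \<open>t\<close> both sides are polynomials in \<open>t\<close>, and their
  difference would have infinitely many roots while its coefficient at degree \<open>i\<close> is a nonzero
  multiple of \<open>c i\<close>.
\<close>

lemma mfun_not_affine_on_box:
  fixes b :: "real ^ 'n::{finite,linorder}"
  assumes "l < u" "i \<in> {2..CARD('n)}" "c i \<noteq> 0"
  shows "\<exists>x \<in> boxX l u. mfun c x \<noteq> b0 + inner b x"
proof (rule ccontr)
  assume "\<not> ?thesis"
  then have eq: "mfun c x = b0 + inner b x" if "x \<in> boxX l u" for x
    using that by blast
  define s where "s = (\<Sum>j\<in>UNIV. b $ j)"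
  define d where "d k = (if k = 0 then - b0 else if k = 1 then - s else c k * real (CARD('n) choose k))" for k
  have n: "CARD('n) \<ge> 2" using assms(2) by simp
  have "(\<Sum>k\<le>CARD('n). d k * t ^ k) = 0" if "t \<in> {l..u}" for t
  proof -
    have "{..CARD('n)} = insert 0 (insert 1 {2..CARD('n)})" using n by auto
    then have "(\<Sum>k\<le>CARD('n). d k * t ^ k) = - b0 - s * t + (\<Sum>k = 2..CARD('n). d k * t ^ k)"
      by (simp add: d_def)
    also have "(\<Sum>k = 2..CARD('n). d k * t ^ k) = mfun c ((\<chi> j. t) :: real ^ 'n::{finite,linorder})"
      unfolding mfun_diagonal by (rule sum.cong) (auto simp: d_def)
    also have "\<dots> = b0 + inner b (\<chi> j. t)"
      using that by (intro eq) (auto simp: boxX_def)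
    also have "\<dots> = b0 + s * t" by (simp add: inner_vec_def s_def sum_distrib_right)
    finally show ?thesis by simp
  qed
  then have "{l..u} \<subseteq> {t. (\<Sum>k\<le>CARD('n). d k * t ^ k) = 0}" by auto
  then have "\<not> finite {t. (\<Sum>k\<le>CARD('n). d k * t ^ k) = 0}"
    using infinite_Icc[OF assms(1)] finite_subset by blast
  then have "d i = 0" using assms(2) polyfun_finite_roots[of d "CARD('n)"] by auto
  with assms(2,3) show False by (auto simp: d_def)
qed

section \<open>Corners of the box\<close>

definition corner :: "real \<Rightarrow> real \<Rightarrow> 'n set \<Rightarrow> real ^ 'n::{finite,linorder}" where
  "corner l u S = (\<chi> j. if j \<in> S then u else l)"

lemma xvec_eq_corner: "xvec l u k = corner l u {j. pos j \<le> k}"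
  by (simp add: xvec_def corner_def)

text \<open>
  A bijection from \<open>S\<close> to \<open>T\<close> and one between the complements glue to a permutation of the
  variables that takes one corner to the other.
\<close>

lemma mfun_corner_cong_card:
  fixes S T :: "'n::{finite,linorder} set"
  assumes "card S = card T"
  shows "mfun c (corner l u S) = mfun c (corner l u T)"
proof -
  obtain f where f: "bij_betw f S T"
    using assms by (metis finite finite_same_card_bij)
  have "card (- S) = card (- T)" using assms by (simp add: Compl_eq_Diff_UNIV card_Diff_subset)
  then obtain g where g: "bij_betw g (- S) (- T)"
    by (metis finite finite_same_card_bij)
  define h where "h j = (if j \<in> S then f j else g j)" for j
  have "bij_betw h S T" "bij_betw h (- S) (- T)"
    using f g bij_betw_cong[of S h f] bij_betw_cong[of "- S" h g] by (auto simp: h_def)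
  then have "bij_betw h (S \<union> - S) (T \<union> - T)"
    by (rule bij_betw_combine) auto
  then have "bij h" by simp
  have "h j \<in> T \<longleftrightarrow> j \<in> S" for j
    using f g by (auto simp: h_def dest: bij_betwE)
  then have "corner l u S = (\<chi> j. corner l u T $ h j)"
    by (simp add: corner_def)
  with mfun_permute[OF \<open>bij h\<close>] show ?thesis by metis
qed

text \<open>
  Moving one coordinate of \<open>x\<close> to either end of \<open>[l, u]\<close> writes the graph point over \<open>x\<close> as a convex
  combination of two graph points, because \<open>m\<close> is affine in that coordinate. Repeating this
  coordinate by coordinate ends at corners.
\<close>

lemma graph_in_convex_hull_corners:
  fixes x :: "real ^ 'n::{finite,linorder}"
  assumes "l < u" "x \<in> boxX l u"
  shows "(x, mfun c x) \<in> convex hull range (\<lambda>S. (corner l u S, mfun c (corner l u S)))"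
    (is "_ \<in> convex hull ?V")
proof -
  \<comment> \<open>\<open>A\<close> collects the coordinates that may still lie strictly between \<open>l\<close> and \<open>u\<close>.\<close>
  have "(x, mfun c x) \<in> convex hull ?V"
    if "finite A" "x \<in> boxX l u" "\<forall>j. j \<notin> A \<longrightarrow> x $ j \<in> {l, u}" for A and x
    using that
  proof (induction A arbitrary: x rule: finite_induct)
    case empty
    then have "x = corner l u {j. x $ j = u}"
      by (auto simp: corner_def vec_eq_iff)
    then have "(x, mfun c x) \<in> ?V" by (metis (mono_tags, lifting) rangeI)
    then show ?case by (rule hull_inc)
  next
    case (insert a A)
    define y z where "y = (\<chi> j. if j = a then l else x $ j)" and "z = (\<chi> j. if j = a then u else x $ j)"
    define t where "t = (x $ a - l) / (u - l)"
    have xa: "l \<le> x $ a" "x $ a \<le> u" using insert.prems(1) by (auto simp: boxX_def)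
    then have t: "0 \<le> t" "t \<le> 1" using \<open>l < u\<close> by (auto simp: t_def)
    have "t * (u - l) = x $ a - l" using \<open>l < u\<close> by (simp add: t_def)
    then have xt: "x $ a = (1 - t) * y $ a + t * z $ a"
      by (simp add: y_def z_def algebra_simps)
    have "(y, mfun c y) \<in> convex hull ?V" "(z, mfun c z) \<in> convex hull ?V"
      using insert.prems \<open>l < u\<close> by (auto intro!: insert.IH simp: boxX_def y_def z_def) metis+
    then have "(1 - t) *\<^sub>R (y, mfun c y) + t *\<^sub>R (z, mfun c z) \<in> convex hull ?V"
      using t by (intro convexD_alt convex_convex_hull)
    moreover have "x = (1 - t) *\<^sub>R y + t *\<^sub>R z"
    proof (rule vec_eq_iff[THEN iffD2], rule allI)
      fix j
      show "x $ j = ((1 - t) *\<^sub>R y + t *\<^sub>R z) $ j"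
        using xt by (cases "j = a") (simp_all add: y_def z_def algebra_simps)
    qed
    moreover have "mfun c x = (1 - t) * mfun c y + t * mfun c z"
      by (rule mfun_affine_in_coordinate[OF _ xt]) (simp add: y_def z_def)
    ultimately show ?case by simp
  qed
  from this[of UNIV] assms(2) show ?thesis by simp
qed

lemma convex_hull_graph_eq_corners:
  assumes "l < u"
  shows "convex hull graphG l u c =
    convex hull range (\<lambda>S :: 'n::{finite,linorder} set. (corner l u S, mfun c (corner l u S)))"
proof (rule antisym)
  show "convex hull graphG l u c \<subseteq> convex hull range (\<lambda>S :: 'n set. (corner l u S, mfun c (corner l u S)))"
    using graph_in_convex_hull_corners[OF assms]
    by (intro hull_minimal convex_convex_hull) (auto simp: graphG_def)
  show "convex hull range (\<lambda>S :: 'n set. (corner l u S, mfun c (corner l u S))) \<subseteq> convex hull graphG l u c"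
    using assms by (intro hull_mono) (auto simp: graphG_def boxX_def corner_def)
qed

section \<open>Initial segments of the index set\<close>

lemma bij_betw_pos: "bij_betw pos (UNIV :: 'n::{finite,linorder} set) {1..CARD('n)}"
proof -
  have less: "pos i < pos j" if "i < j" for i j :: 'n
    unfolding pos_def using that by (intro psubset_card_mono) auto
  then have inj: "inj (pos :: 'n \<Rightarrow> nat)"
    by (metis injI linorder_neqE nat_neq_iff)
  have "pos j \<in> {1..CARD('n)}" for j :: 'n
    by (auto simp: pos_def card_mono Suc_le_eq card_gt_0_iff)
  then have "pos ` (UNIV :: 'n set) \<subseteq> {1..CARD('n)}" by auto
  then have "pos ` (UNIV :: 'n set) = {1..CARD('n)}"
    using inj by (intro card_subset_eq) (auto simp: card_image)
  with inj show ?thesis by (simp add: bij_betw_def)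
qed

lemma pos_less_imp_less:
  fixes i j :: "'n::{finite,linorder}"
  assumes "pos i < pos j"
  shows "i < j"
proof (rule ccontr)
  assume "\<not> i < j"
  then have "card {..j} \<le> card {..i}" by (intro card_mono) auto
  with assms show False by (simp add: pos_def)
qed

lemma card_initial_segment:
  assumes "k \<le> CARD('n::{finite,linorder})"
  shows "card {j :: 'n::{finite,linorder}. pos j \<le> k} = k"
proof -
  have "pos ` {j :: 'n. pos j \<le> k} = {..k} \<inter> range (pos :: 'n \<Rightarrow> nat)" by auto
  also have "\<dots> = {1..k}" using bij_betw_pos[where 'n = 'n] assms by (auto simp: bij_betw_def)
  finally have "pos ` {j :: 'n. pos j \<le> k} = {1..k}" .
  moreover have "inj_on pos {j :: 'n. pos j \<le> k}"
    using bij_betw_pos[where 'n = 'n] by (auto simp: bij_betw_def intro: inj_on_subset)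
  ultimately show ?thesis by (metis card_atLeastAtMost card_image diff_Suc_1)
qed

text \<open>
  The symmetric difference of \<open>S\<close> and the initial segment of the same size splits into pairs
  \<open>i < f i\<close>, with \<open>i\<close> from the segment and \<open>f i\<close> from \<open>S\<close>. The difference of the two sums is the sum
  of the differences \<open>b $ f i - b $ i\<close>, each nonnegative; equality of the sums makes every pair a tie
  of \<open>b\<close> and hence of \<open>d\<close>.
\<close>

lemma initial_segment_exchange:
  fixes b d :: "real ^ 'n::{finite,linorder}"
  assumes mono: "\<And>i j. i \<le> j \<Longrightarrow> b $ i \<le> b $ j"
    and ties: "\<And>i j. i < j \<Longrightarrow> b $ i = b $ j \<Longrightarrow> d $ i = d $ j"
    and card: "card S = card {j :: 'n. pos j \<le> k}"
  shows "(\<Sum>j | pos j \<le> k. b $ j) \<le> (\<Sum>j\<in>S. b $ j)"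
    and "(\<Sum>j\<in>S. b $ j) = (\<Sum>j | pos j \<le> k. b $ j) \<Longrightarrow> (\<Sum>j\<in>S. d $ j) = (\<Sum>j | pos j \<le> k. d $ j)"
proof -
  define T where "T = {j :: 'n. pos j \<le> k}"
  have "card (T - S) = card (S - T)"
    using card by (simp add: T_def card_Diff_subset_Int Int_commute)
  then obtain f where f: "bij_betw f (T - S) (S - T)"
    by (metis finite finite_same_card_bij)
  have less: "i < f i" if "i \<in> T - S" for i
  proof (rule pos_less_imp_less)
    have "f i \<in> S - T" using f that by (auto dest: bij_betwE)
    with that show "pos i < pos (f i)" by (auto simp: T_def)
  qed
  have split: "(\<Sum>j\<in>S. e $ j) - (\<Sum>j\<in>T. e $ j) = (\<Sum>i\<in>T - S. e $ f i - e $ i)" for e :: "real ^ 'n::{finite,linorder}"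
  proof -
    have "(\<Sum>i\<in>T - S. e $ f i) = (\<Sum>j\<in>S - T. e $ j)"
      using f by (rule sum.reindex_bij_betw)
    moreover have "(\<Sum>j\<in>S. e $ j) = (\<Sum>j\<in>S \<inter> T. e $ j) + (\<Sum>j\<in>S - T. e $ j)"
      by (rule sum.Int_Diff) simp
    moreover have "(\<Sum>j\<in>T. e $ j) = (\<Sum>j\<in>T \<inter> S. e $ j) + (\<Sum>j\<in>T - S. e $ j)"
      by (rule sum.Int_Diff) simp
    ultimately show ?thesis by (simp add: sum_subtractf Int_commute)
  qed
  have nonneg: "0 \<le> b $ f i - b $ i" if "i \<in> T - S" for i
    using mono less[OF that] by (simp add: less_imp_le)
  then have "0 \<le> (\<Sum>i\<in>T - S. b $ f i - b $ i)" by (rule sum_nonneg)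
  with split[of b] show "(\<Sum>j | pos j \<le> k. b $ j) \<le> (\<Sum>j\<in>S. b $ j)"
    by (simp add: T_def)
  assume "(\<Sum>j\<in>S. b $ j) = (\<Sum>j | pos j \<le> k. b $ j)"
  with split[of b] have "(\<Sum>i\<in>T - S. b $ f i - b $ i) = 0" by (simp add: T_def)
  then have "b $ f i - b $ i = 0" if "i \<in> T - S" for i
    using nonneg that sum_nonneg_eq_0_iff[of "T - S" "\<lambda>i. b $ f i - b $ i"] by auto
  then have "d $ i = d $ f i" if "i \<in> T - S" for i
    using ties[OF less[OF that]] that by auto
  then have "(\<Sum>i\<in>T - S. d $ f i - d $ i) = 0" by (intro sum.neutral) auto
  with split[of d] show "(\<Sum>j\<in>S. d $ j) = (\<Sum>j | pos j \<le> k. d $ j)" by (simp add: T_def)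
qed

text \<open>
  This separates the value at a corner into the value at \<open>x\<^sup>k\<close> and an excess that depends on
  the linear coefficients alone.
\<close>

lemma lhs_corner:
  fixes b :: "real ^ 'n::{finite,linorder}"
  assumes card: "card S = k" and k: "k \<le> CARD('n)"
  shows "lhs b0 b b' (corner l u S, mfun c (corner l u S)) =
    Lk l u k b0 b + b' * mfun c (xvec l u k :: real ^ 'n::{finite,linorder})
      + (u - l) * ((\<Sum>j\<in>S. b $ j) - (\<Sum>j | pos j \<le> k. b $ j))"
proof -
  have lin: "(\<Sum>j\<in>UNIV. b $ j * corner l u R $ j) = l * (\<Sum>j\<in>UNIV. b $ j) + (u - l) * (\<Sum>j\<in>R. b $ j)" for R
  proof -
    have "(\<Sum>j\<in>UNIV. b $ j * corner l u R $ j) = (\<Sum>j\<in>UNIV. l * b $ j + (if j \<in> R then (u - l) * b $ j else 0))"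
      by (rule sum.cong) (auto simp: corner_def algebra_simps)
    also have "\<dots> = l * (\<Sum>j\<in>UNIV. b $ j) + (u - l) * (\<Sum>j\<in>R. b $ j)"
      by (simp add: sum.distrib sum_distrib_left sum.If_cases)
    finally show ?thesis .
  qed
  have "mfun c (corner l u S) = mfun c (xvec l u k :: real ^ 'n::{finite,linorder})"
    unfolding xvec_eq_corner using card card_initial_segment[OF k] by (intro mfun_corner_cong_card) simp
  moreover have "(\<Sum>j\<in>UNIV. b $ j) = (\<Sum>j | pos j \<le> k. b $ j) + (\<Sum>j | k < pos j. b $ j)"
    by (subst sum.union_disjoint[symmetric]) (auto intro!: sum.cong)
  ultimately show ?thesis
    unfolding lhs_def Lk_def by (simp add: lin algebra_simps)
qed

section \<open>Comparing two core inequalities\<close>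

text \<open>
  In the decomposition \<open>lhs_corner\<close> for \<open>hat\<close> both the value at \<open>x\<^sup>k\<close> and the excess are
  nonnegative, so tightness forces both to vanish. Each of the two facts carries over to \<open>bar\<close>: the
  first by the assumption on the points \<open>x\<^sup>k\<close>, the second by the assumption on ties.
\<close>

lemma tight_corner_transfer:
  fixes bar hat :: "real ^ 'n::{finite,linorder}"
  assumes lu: "l < u"
    and core: "core_ineq hat b'"
    and nonneg: "\<And>S. lhs hat0 hat b' (corner l u S, mfun c (corner l u S)) \<ge> 0"
    and ties: "\<And>i j. i < j \<Longrightarrow> hat $ i = hat $ j \<Longrightarrow> bar $ i = bar $ j"
    and tight_chain: "\<And>k. k \<le> CARD('n) \<Longrightarrow>
        Lk l u k hat0 hat + b' * mfun c (xvec l u k :: real ^ 'n::{finite,linorder}) = 0 \<Longrightarrow>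
        Lk l u k bar0 bar + b' * mfun c (xvec l u k :: real ^ 'n::{finite,linorder}) = 0"
    and tight: "lhs hat0 hat b' (corner l u S, mfun c (corner l u S)) = 0"
  shows "lhs bar0 bar b' (corner l u S, mfun c (corner l u S)) = 0"
proof -
  define k where "k = card S"
  define T where "T = {j :: 'n. pos j \<le> k}"
  have k: "k \<le> CARD('n)" by (simp add: k_def card_mono)
  have cT: "card T = k" unfolding T_def by (rule card_initial_segment[OF k])
  have cS: "card S = card {j :: 'n. pos j \<le> k}" using cT by (simp add: k_def T_def)
  have mono: "\<And>i j. i \<le> j \<Longrightarrow> hat $ i \<le> hat $ j" using core by (simp add: core_ineq_def)
  have le: "(\<Sum>j | pos j \<le> k. hat $ j) \<le> (\<Sum>j\<in>S. hat $ j)"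
    by (rule initial_segment_exchange(1)[of hat bar]) (fact mono ties cS)+
  have eq: "(\<Sum>j\<in>S. bar $ j) = (\<Sum>j | pos j \<le> k. bar $ j)"
    if "(\<Sum>j\<in>S. hat $ j) = (\<Sum>j | pos j \<le> k. hat $ j)"
    by (rule initial_segment_exchange(2)[of hat bar]) (fact mono ties cS that)+
  note S = lhs_corner[OF k_def[symmetric] k]
  have chain: "0 \<le> Lk l u k hat0 hat + b' * mfun c (xvec l u k :: real ^ 'n::{finite,linorder})"
    using nonneg[of T] lhs_corner[OF cT k, of hat0 hat b' l u c] by (simp add: T_def)
  have "0 \<le> (u - l) * ((\<Sum>j\<in>S. hat $ j) - (\<Sum>j | pos j \<le> k. hat $ j))"
    using le lu by (intro mult_nonneg_nonneg) auto
  with chain tight S[of hat0 hat b' l u c]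
  have zero: "Lk l u k hat0 hat + b' * mfun c (xvec l u k :: real ^ 'n::{finite,linorder}) = 0"
    and "(u - l) * ((\<Sum>j\<in>S. hat $ j) - (\<Sum>j | pos j \<le> k. hat $ j)) = 0"
    by linarith+
  then have "(\<Sum>j\<in>S. hat $ j) = (\<Sum>j | pos j \<le> k. hat $ j)" using lu by simp
  then have "(\<Sum>j\<in>S. bar $ j) = (\<Sum>j | pos j \<le> k. bar $ j)" by (rule eq)
  with tight_chain[OF k zero] S[of bar0 bar b' l u c] show ?thesis by simp
qed

theorem proposition3p4:
  fixes l u :: real
    and c :: "nat \<Rightarrow> real"
    and bar0 hat0 b' :: real
    and bar hat :: "real ^ 'n::{finite,linorder}"
  assumes "CARD('n) \<ge> 2"
    and "l < u"
    and "\<exists>i\<in>{2..CARD('n)}. c i \<noteq> 0"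
    and "valid_core_ineq (convex hull (graphG l u c)) bar0 bar b'"
    and "valid_core_ineq (convex hull (graphG l u c)) hat0 hat b'"
    and "\<And>i j. i < j \<Longrightarrow> hat $ i = hat $ j \<Longrightarrow> bar $ i = bar $ j"
    and "{k \<in> {0..CARD('n)}. Lk l u k hat0 hat + b' * mfun c (xvec l u k :: real ^ 'n::{finite,linorder}) = 0}
         \<subset> {k \<in> {0..CARD('n)}. Lk l u k bar0 bar + b' * mfun c (xvec l u k :: real ^ 'n::{finite,linorder}) = 0}"
  shows "\<not> is_facet_ineq (convex hull (graphG l u c)) hat0 hat b'"

proof
  let ?v = "\<lambda>S :: 'n set. (corner l u S, mfun c (corner l u S))"
  define P where "P = convex hull (graphG l u c :: ((real ^ 'n::{finite,linorder}) \<times> real) set)"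
  define F where "F = {p \<in> P. lhs hat0 hat b' p = 0}"
  define F' where "F' = {p \<in> P. lhs bar0 bar b' p = 0}"
  assume "is_facet_ineq (convex hull (graphG l u c)) hat0 hat b'"
  then have facet: "F facet_of P" by (simp add: is_facet_ineq_def F_def P_def)
  have P: "P = convex hull (range ?v)"
    unfolding P_def using assms(2) by (rule convex_hull_graph_eq_corners)
  have convP: "convex P" by (simp add: P_def)
  have bar: "core_ineq bar b'" "valid_ineq P bar0 bar b'"
    and hat: "core_ineq hat b'" "valid_ineq P hat0 hat b'"
    using assms(4,5) by (auto simp: valid_core_ineq_def P_def)
  have v: "?v S \<in> P" for S unfolding P by (rule hull_inc) simp
  have face: "F face_of P" and face': "F' face_of P"
    unfolding F_def F'_def using convP hat(2) bar(2) by (auto intro: valid_ineq_face_of)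
  have tight: "?v S \<in> F'" if "?v S \<in> F" for S
  proof -
    have "lhs bar0 bar b' (?v S) = 0"
    proof (rule tight_corner_transfer[where hat = hat and ?hat0.0 = hat0])
      show "lhs hat0 hat b' (?v R) \<ge> 0" for R
        using hat(2) v by (auto simp: valid_ineq_def)
      show "lhs hat0 hat b' (?v S) = 0" using that by (simp add: F_def)
    qed (use assms(2,6,7) hat(1) in auto)
    with v show ?thesis by (simp add: F'_def)
  qed
  \<comment> \<open>A face of a polytope is the hull of the generators it contains, so corners suffice.\<close>
  have "F \<subseteq> F'"
  proof -
    have "compact (range ?v)" by (intro finite_imp_compact) simp
    then obtain V where V: "V \<subseteq> range ?v" "F = convex hull V"
      using face unfolding P by (rule face_of_convex_hull_subset)
    have "V \<subseteq> F" unfolding V(2) by (rule hull_subset)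
    with V(1) tight have "V \<subseteq> F'" by blast
    with V(2) face_of_imp_convex[OF face'] convP show ?thesis by (simp add: hull_minimal)
  qed
  moreover have "F \<noteq> F'"
  proof -
    obtain k where k: "k \<le> CARD('n)"
      "Lk l u k bar0 bar + b' * mfun c (xvec l u k :: real ^ 'n::{finite,linorder}) = 0"
      "Lk l u k hat0 hat + b' * mfun c (xvec l u k :: real ^ 'n::{finite,linorder}) \<noteq> 0"
      using assms(7) by auto
    let ?T = "{j :: 'n. pos j \<le> k}"
    note T = lhs_corner[OF card_initial_segment[OF k(1)] k(1)]
    have "?v ?T \<in> F'" "?v ?T \<notin> F"
      using k v by (auto simp: F_def F'_def T)
    then show ?thesis by blast
  qed
  ultimately have "aff_dim F < aff_dim F'"
    using face face' by (meson face_of_aff_dim_lt face_of_imp_convex face_of_imp_subset face_of_subset convP)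
  moreover have "aff_dim F' < aff_dim P"
  proof (rule face_of_aff_dim_lt[OF convP face'])
    obtain i where i: "i \<in> {2..CARD('n)}" "c i \<noteq> 0" using assms(3) by blast
    \<comment> \<open>Since \<open>b'\<close> is its own inverse, \<open>F' = P\<close> would mean \<open>m(x) = - b' (bar0 + bar \<bullet> x)\<close>.\<close>
    obtain x :: "real ^ 'n::{finite,linorder}" where x: "x \<in> boxX l u" "mfun c x \<noteq> - bar0 * b' + inner (- b' *\<^sub>R bar) x"
      using mfun_not_affine_on_box[OF assms(2) i(1), of c] i(2) by blast
    have "(x, mfun c x) \<in> P"
      using x(1) by (auto simp: P_def graphG_def intro: hull_inc)
    moreover have "lhs bar0 bar b' (x, mfun c x) \<noteq> 0"
      using x(2) bar(1) by (auto simp: lhs_eq_inner core_ineq_def algebra_simps)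
    ultimately show "F' \<noteq> P" by (auto simp: F'_def)
  qed
  ultimately show False using facet by (simp add: facet_of_def)
qed

end
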